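(* Fix $d\ge1$, $\alpha\in(0,d)$ and $p\in[2,\infty)$. For each prime power $q$ let $\mathbb{P}$ be the uniform probability measure on the collection of all subsets of $\mathbb{F}_q^d$ of cardinality $\lfloor q^\alpha\rfloor$, and let $X$ denote a random such subset. Let $C:\mathbb{Z}^+\to(0,\infty)$ be a non-decreasing function with $C(q)\to\infty$ as $q\to\infty$. Then, as $q\to\infty$ through prime powers, \[ \mathbb{P}\Big(\|\widehat X\|_p>C(q)\,q^{-d}q^{\alpha/2}\Big)=O(1/C(q))\to0. \]
   Context: $\chi$ is a fixed non-trivial additive character of $\mathbb{F}_q$. For $X\subseteq\mathbb{F}_q^d$, $\widehat X(x)=q^{-d}\sum_{y\in X}\chi(-x\cdot y)$ and $\|\widehat X\|_p=\big(q^{-d}\sum_{x\in\mathbb{F}_q^d\setminus\{0\}}|\widehat X(x)|^p\big)^{1/p}$. *)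

theory Defs
  imports
    "HOL-Probability.Probability"
    "HOL-Algebra.Ring"
    "HOL-Number_Theory.Prime_Powers"
    "HOL-Library.Landau_Symbols"
begin

text \<open>
  Since the field has to vary with its order \<open>q\<close>, finite fields are carrier-based rings, and
  \<open>F\<^sup>d\<close> is the set of extensional functions from \<open>{..<d}\<close> to the carrier. In the
  definitions below, \<open>q\<close> is the cardinality of the carrier.
\<close>

definition vecs :: "('a, 'm) ring_scheme \<Rightarrow> nat \<Rightarrow> (nat \<Rightarrow> 'a) set" where
  "vecs F d = {..<d} \<rightarrow>\<^sub>E carrier F"

definition zero_vec :: "('a, 'm) ring_scheme \<Rightarrow> nat \<Rightarrow> nat \<Rightarrow> 'a" where
  "zero_vec F d = (\<lambda>i\<in>{..<d}. \<zero>\<^bsub>F\<^esub>)"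

definition dot :: "('a, 'm) ring_scheme \<Rightarrow> nat \<Rightarrow> (nat \<Rightarrow> 'a) \<Rightarrow> (nat \<Rightarrow> 'a) \<Rightarrow> 'a" where
  "dot F d x y = (\<Oplus>\<^bsub>F\<^esub>i\<in>{..<d}. x i \<otimes>\<^bsub>F\<^esub> y i)"

definition additive_character :: "('a, 'm) ring_scheme \<Rightarrow> ('a \<Rightarrow> complex) \<Rightarrow> bool" where
  "additive_character F \<psi> \<longleftrightarrow>
     (\<forall>a\<in>carrier F. cmod (\<psi> a) = 1) \<and>
     (\<forall>a\<in>carrier F. \<forall>b\<in>carrier F. \<psi> (a \<oplus>\<^bsub>F\<^esub> b) = \<psi> a * \<psi> b)"

definition nontrivial_additive_character :: "('a, 'm) ring_scheme \<Rightarrow> ('a \<Rightarrow> complex) \<Rightarrow> bool" where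
  "nontrivial_additive_character F \<psi> \<longleftrightarrow>
     additive_character F \<psi> \<and> (\<exists>a\<in>carrier F. \<psi> a \<noteq> 1)"

definition fourier ::
  "('a, 'm) ring_scheme \<Rightarrow> nat \<Rightarrow> ('a \<Rightarrow> complex) \<Rightarrow> (nat \<Rightarrow> 'a) set \<Rightarrow> (nat \<Rightarrow> 'a) \<Rightarrow> complex" where
  "fourier F d \<psi> X x =
     (1 / of_nat (card (carrier F)) ^ d) * (\<Sum>y\<in>X. \<psi> (\<ominus>\<^bsub>F\<^esub> dot F d x y))"

definition fourier_norm ::
  "('a, 'm) ring_scheme \<Rightarrow> nat \<Rightarrow> ('a \<Rightarrow> complex) \<Rightarrow> real \<Rightarrow> (nat \<Rightarrow> 'a) set \<Rightarrow> real" where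
  "fourier_norm F d \<psi> p X =
     ((1 / real (card (carrier F)) ^ d) *
        (\<Sum>x\<in>vecs F d - {zero_vec F d}. cmod (fourier F d \<psi> X x) powr p)) powr (1 / p)"

definition subsets_of_card :: "('a, 'm) ring_scheme \<Rightarrow> nat \<Rightarrow> nat \<Rightarrow> (nat \<Rightarrow> 'a) set set" where
  "subsets_of_card F d m = {X. X \<subseteq> vecs F d \<and> card X = m}"

definition primepow_at_top :: "nat filter" where
  "primepow_at_top = inf at_top (principal {q. primepow q})"

end

theory Submission imports Defs begin

text \<open>
  For \<open>x \<noteq> 0\<close> the values \<open>\<chi>(-x\<cdot>y)\<close> have modulus 1 and sum to 0 over \<open>F\<^sup>d\<close>. Removing one element
  from the population at a time and following the change of the population mean shows that sums
  over a random set of size \<open>m\<close>, drawn without replacement, are subgaussian with variance proxy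
  \<open>O(m)\<close>. Hence the \<open>p\<close>-th moment of the character sum over \<open>X\<close> is \<open>O(m\<^bsup>p/2\<^esup>)\<close> with a constant
  depending on \<open>p\<close> only; averaging over \<open>x\<close> and applying Markov's inequality to the \<open>p\<close>-th power
  of the norm gives the probability bound \<open>O(C(q)\<^bsup>-p\<^esup>)\<close>.
\<close>

section \<open>Sampling without replacement\<close>

text \<open>Double counting of the pairs of a set \<open>X\<close> of size \<open>Suc m\<close> and
  a point \<open>y\<close> in it. In terms of samples, this conditions on one drawn point
  \<open>y\<close>, leaving a sample of size \<open>m\<close> from \<open>V - {y}\<close>, which
  drives the induction on \<open>m\<close>.\<close>

lemma sum_subsets_Suc:
  fixes g :: "'b set \<Rightarrow> real"
  assumes V: "finite V"
  shows "real (Suc m) * (\<Sum>X | X \<subseteq> V \<and> card X = Suc m. g X) =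
         (\<Sum>y\<in>V. \<Sum>X | X \<subseteq> V - {y} \<and> card X = m. g (insert y X))"
proof -
  let ?A = "{X. X \<subseteq> V \<and> card X = Suc m}"
  let ?B = "\<lambda>y. {X. X \<subseteq> V - {y} \<and> card X = m}"
  have fin: "finite X" if "X \<subseteq> V" for X
    using V that finite_subset by blast
  have finA: "finite ?A" and finB: "finite (?B y)" for y
    using V by simp_all
  have "real (Suc m) * (\<Sum>X\<in>?A. g X) = (\<Sum>X\<in>?A. \<Sum>y\<in>X. g X)"
    by (simp add: sum_distrib_left)
  also have "\<dots> = (\<Sum>(X, y)\<in>Sigma ?A (\<lambda>X. X). g X)"
    using finA fin by (subst sum.Sigma) auto
  also have "\<dots> = (\<Sum>(y, X)\<in>Sigma V ?B. g (insert y X))"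
  proof (rule sum.reindex_bij_witness
      [where i = "\<lambda>(y, X). (insert y X, y)" and j = "\<lambda>(X, y). (y, X - {y})"], goal_cases)
    case (4 b)
    then obtain y X where b: "b = (y, X)" "y \<in> V" "X \<subseteq> V - {y}" "card X = m" by auto
    moreover have "finite X" "y \<notin> X" using b fin by auto
    ultimately show ?case by auto
  qed (auto simp: fin insert_absorb)
  also have "\<dots> = (\<Sum>y\<in>V. \<Sum>X\<in>?B y. g (insert y X))"
    using V finB by (subst sum.Sigma) auto
  finally show ?thesis .
qed

text \<open>For t = -s < 0 the claim is equivalent to 1 \<le> (1 - s + s^2) exp s. Bounding exp s
  below by its quadratic Taylor polynomial leaves a product that exceeds 1 by terms with positive
  coefficients only.\<close>

lemma exp_le_quadratic:
  fixes t :: real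
  assumes "\<bar>t\<bar> \<le> 1"
  shows "exp t \<le> 1 + t + t\<^sup>2"
proof (cases "t \<ge> 0")
  case True
  then show ?thesis using assms exp_bound[of t] by simp
next
  case False
  define s where "s = - t"
  have s: "0 < s" "s \<le> 1" using False assms by (auto simp: s_def)
  have "1 + s + s\<^sup>2 / 2 \<le> exp s"
    using exp_lower_Taylor_quadratic[of s] s by simp
  moreover have "1 \<le> (1 - s + s\<^sup>2) * (1 + s + s\<^sup>2 / 2)"
  proof -
    have "(1 - s + s\<^sup>2) * (1 + s + s\<^sup>2 / 2) = 1 + s\<^sup>2 / 2 + s ^ 3 / 2 + s ^ 4 / 2"
      by (simp add: field_simps power_numeral_reduce)
    then show ?thesis using s by simp
  qed
  moreover have "0 \<le> 1 - s + s\<^sup>2" using s by simp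
  ultimately have "1 \<le> (1 - s + s\<^sup>2) * exp s"
    by (meson mult_left_mono order_trans)
  then have "exp (- s) \<le> 1 - s + s\<^sup>2"
    by (simp add: exp_minus field_simps)
  then show ?thesis by (simp add: s_def)
qed

text \<open>The exponential moment of a single centred draw: after the quadratic bound on exp, the
  linear terms cancel because \<open>h\<close> sums to zero.\<close>

lemma sum_exp_centered_le:
  fixes h :: "'b \<Rightarrow> real"
  assumes V: "finite V" and h: "\<And>y. y \<in> V \<Longrightarrow> \<bar>h y\<bar> \<le> s" and s: "s \<le> 1"
    and h0: "sum h V = 0"
  shows "(\<Sum>y\<in>V. exp (h y)) \<le> real (card V) * exp (s\<^sup>2)"
proof -
  have "(\<Sum>y\<in>V. exp (h y)) \<le> (\<Sum>y\<in>V. 1 + h y + s\<^sup>2)"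
  proof (rule sum_mono)
    fix y assume y: "y \<in> V"
    have "exp (h y) \<le> 1 + h y + (h y)\<^sup>2"
      using h[OF y] s by (intro exp_le_quadratic) simp
    also have "(h y)\<^sup>2 \<le> s\<^sup>2"
      using h[OF y] by (simp add: abs_le_square_iff[symmetric])
    finally show "exp (h y) \<le> 1 + h y + s\<^sup>2" by simp
  qed
  also have "\<dots> = real (card V) * (1 + s\<^sup>2)"
    by (simp add: sum.distrib h0 algebra_simps)
  also have "\<dots> \<le> real (card V) * exp (s\<^sup>2)"
    by (intro mult_left_mono exp_ge_add_one_self) simp
  finally show ?thesis .
qed

text \<open>
  Removing \<open>y\<close> moves the population mean from \<open>\<mu>\<close> to \<open>\<mu> - (f y - \<mu>)/(N - 1)\<close>, so in the induction
  on \<open>m\<close> the deviation \<open>f y - \<mu>\<close> enters with a factor \<open>1 - m/(N - 1)\<close> between 0 and 1.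
\<close>

lemma sum_subsets_exp_le:
  fixes f :: "'b \<Rightarrow> real"
  assumes "finite V" and "\<And>y. y \<in> V \<Longrightarrow> \<bar>f y\<bar> \<le> 1" and l: "\<bar>l\<bar> \<le> 1 / 2"
  shows "(\<Sum>X | X \<subseteq> V \<and> card X = m. exp (l * sum f X)) \<le>
         real (card V choose m) * exp (l * (real m * (sum f V / real (card V))) + 4 * l\<^sup>2 * real m)"
  using assms(1,2)
proof (induction m arbitrary: V)
  case 0
  have "{X. X \<subseteq> V \<and> card X = 0} = {{}}"
    using 0 by (auto simp: card_eq_0_iff dest: finite_subset)
  then show ?case by simp
next
  case (Suc m V)
  show ?case
  proof (cases "Suc m \<le> card V")
    case False
    then have "{X. X \<subseteq> V \<and> card X = Suc m} = {}"
      by (auto dest: card_mono[OF Suc.prems(1)])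
    then show ?thesis by (simp only: sum.empty) simp
  next
    case True
    define N where "N = card V"
    define \<mu> where "\<mu> = sum f V / real N"
    define c where "c = 1 - real m / (real N - 1)"
    have N: "Suc m \<le> N" "N > 0" using True by (auto simp: N_def)
    have c: "0 \<le> c" "c \<le> 1" using N by (auto simp: c_def divide_le_eq_1)
    have sumf: "sum f V = real N * \<mu>" using N by (simp add: \<mu>_def)
    have \<mu>: "\<bar>\<mu>\<bar> \<le> 1"
    proof -
      have "\<bar>sum f V\<bar> \<le> (\<Sum>y\<in>V. 1)"
        using Suc.prems(2) by (intro order_trans[OF sum_abs] sum_mono)
      then show ?thesis using N by (simp add: \<mu>_def N_def field_simps)
    qed
    have split: "l * f y + l * (real m * (sum f (V - {y}) / real (card (V - {y})))) =
                 l * (real (Suc m) * \<mu>) + l * c * (f y - \<mu>)" if y: "y \<in> V" for y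
    \<comment> \<open>If \<open>N = 1\<close>, then \<open>m = 0\<close> and the mean over the empty
      set \<open>V - {y}\<close> is a division by zero. Its weight \<open>m = 0\<close> removes it,
      and \<open>c = 1\<close>.\<close>
    proof (cases "m = 0")
      case True
      then show ?thesis by (simp add: c_def algebra_simps)
    next
      case False
      then have N1: "real N - 1 > 0" using N by simp
      have "card (V - {y}) = N - 1" using y Suc.prems(1) by (simp add: N_def)
      then have card: "real (card (V - {y})) = real N - 1" using N by simp
      have diff: "sum f (V - {y}) = real N * \<mu> - f y"
        using y Suc.prems(1) by (simp add: sum_diff1 sumf)
      show ?thesis
        unfolding card diff c_def using N1 by (simp add: field_simps)
    qed
    have "real (Suc m) * (\<Sum>X | X \<subseteq> V \<and> card X = Suc m. exp (l * sum f X)) =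
          (\<Sum>y\<in>V. \<Sum>X | X \<subseteq> V - {y} \<and> card X = m. exp (l * sum f (insert y X)))"
      by (rule sum_subsets_Suc) fact
    also have "\<dots> = (\<Sum>y\<in>V. exp (l * f y) * (\<Sum>X | X \<subseteq> V - {y} \<and> card X = m. exp (l * sum f X)))"
    proof (intro sum.cong refl)
      fix y assume "y \<in> V"
      have "sum f (insert y X) = f y + sum f X" if "X \<subseteq> V - {y}" for X
        using that Suc.prems(1) by (subst sum.insert) (auto dest: finite_subset)
      then show "(\<Sum>X | X \<subseteq> V - {y} \<and> card X = m. exp (l * sum f (insert y X))) =
            exp (l * f y) * (\<Sum>X | X \<subseteq> V - {y} \<and> card X = m. exp (l * sum f X))"
        by (subst sum_distrib_left, intro sum.cong refl) (simp add: distrib_left exp_add)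
    qed
    also have "\<dots> \<le> (\<Sum>y\<in>V. exp (l * f y) * (real (card (V - {y}) choose m) *
        exp (l * (real m * (sum f (V - {y}) / real (card (V - {y})))) + 4 * l\<^sup>2 * real m)))"
      using Suc.prems by (intro sum_mono mult_left_mono Suc.IH) auto
    also have "\<dots> = (\<Sum>y\<in>V. real (N - 1 choose m) * exp (l * (real (Suc m) * \<mu>) + 4 * l\<^sup>2 * real m) *
        exp (l * c * (f y - \<mu>)))"
    proof (intro sum.cong refl)
      fix y assume y: "y \<in> V"
      let ?u = "l * (real m * (sum f (V - {y}) / real (card (V - {y}))))"
      let ?w = "4 * l\<^sup>2 * real m"
      have card: "card (V - {y}) = N - 1" using y Suc.prems(1) by (simp add: N_def)
      have "exp (l * f y) * (real (card (V - {y}) choose m) * exp (?u + ?w)) =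
          real (N - 1 choose m) * exp (l * f y + ?u + ?w)"
        unfolding card by (simp add: exp_add)
      also have "\<dots> = real (N - 1 choose m) *
          exp (l * (real (Suc m) * \<mu>) + l * c * (f y - \<mu>) + ?w)"
        by (simp only: split[OF y])
      finally show "exp (l * f y) * (real (card (V - {y}) choose m) * exp (?u + ?w)) =
          real (N - 1 choose m) * exp (l * (real (Suc m) * \<mu>) + ?w) * exp (l * c * (f y - \<mu>))"
        by (simp only: exp_add mult_ac)
    qed
    also have "\<dots> = real (N - 1 choose m) * exp (l * (real (Suc m) * \<mu>) + 4 * l\<^sup>2 * real m) *
        (\<Sum>y\<in>V. exp (l * c * (f y - \<mu>)))"
      by (simp add: sum_distrib_left)
    \<comment> \<open>Since \<open>f\<close> and its mean \<mu> lie in [-1, 1] and \<open>c\<close>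
      in [0, 1], the centred exponents are at most 2|l|, which is at most 1 by the assumption on
      \<open>l\<close>. So each draw adds (2|l|)^2 to the exponent, the source of the factor
      4.\<close>
    also have "\<dots> \<le> real (N - 1 choose m) * exp (l * (real (Suc m) * \<mu>) + 4 * l\<^sup>2 * real m) *
        (real N * exp ((2 * \<bar>l\<bar>)\<^sup>2))"
      unfolding N_def
    proof (intro mult_left_mono sum_exp_centered_le)
      fix y assume y: "y \<in> V"
      have "\<bar>f y - \<mu>\<bar> \<le> 2" using Suc.prems(2)[OF y] \<mu> by linarith
      then have "\<bar>c\<bar> * \<bar>f y - \<mu>\<bar> \<le> 1 * 2" using c by (intro mult_mono) auto
      then have "\<bar>l\<bar> * (\<bar>c\<bar> * \<bar>f y - \<mu>\<bar>) \<le> \<bar>l\<bar> * 2" by (intro mult_left_mono) auto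
      then show "\<bar>l * c * (f y - \<mu>)\<bar> \<le> 2 * \<bar>l\<bar>" by (simp add: abs_mult mult_ac)
    next
      show "(\<Sum>y\<in>V. l * c * (f y - \<mu>)) = 0"
        by (simp add: sum_distrib_left[symmetric] sum_subtractf sumf N_def)
    qed (use Suc.prems l in auto)
    also have "\<dots> = real (N * (N - 1 choose m)) *
        exp (l * (real (Suc m) * \<mu>) + 4 * l\<^sup>2 * real (Suc m))"
    proof -
      have "4 * l\<^sup>2 * real (Suc m) = 4 * l\<^sup>2 * real m + (2 * \<bar>l\<bar>)\<^sup>2"
        by (simp add: algebra_simps power_mult_distrib)
      then show ?thesis by (simp only: exp_add of_nat_mult mult_ac)
    qed
    \<comment> \<open>Absorption identity; it produces the factor \<open>Suc m\<close> that the
      double counting put on the left.\<close>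
    also have "N * (N - 1 choose m) = Suc m * (N choose Suc m)"
      using N Suc_times_binomial_eq[of "N - 1" m] by (simp add: mult.commute)
    finally have "real (Suc m) * (\<Sum>X | X \<subseteq> V \<and> card X = Suc m. exp (l * sum f X)) \<le>
        real (Suc m) * (real (N choose Suc m) *
          exp (l * (real (Suc m) * \<mu>) + 4 * l\<^sup>2 * real (Suc m)))"
      by (simp only: of_nat_mult mult.assoc)
    then show ?thesis
      unfolding \<mu>_def N_def by (rule mult_left_le_imp_le) simp
  qed
qed

section \<open>From exponential moments to absolute moments\<close>

text \<open>For |t| > 1 the exponent is rounded up to an integer n and |t|^n / n! is one term of the
  series of exp |t|. The sum of two exponentials removes the absolute value, so that exponential
  moments at \<open>l\<close> and \<open>-l\<close> suffice.\<close>

lemma abs_powr_le_exp: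
  fixes t p :: real
  assumes p: "0 \<le> p"
  shows "\<bar>t\<bar> powr p \<le> fact (nat \<lceil>p\<rceil>) * (exp t + exp (- t))"
proof -
  let ?n = "nat \<lceil>p\<rceil>"
  have "\<bar>t\<bar> powr p \<le> fact ?n * exp \<bar>t\<bar>"
  proof (cases "\<bar>t\<bar> \<le> 1")
    case True
    then have "\<bar>t\<bar> powr p \<le> 1 powr p" using p by (intro powr_mono2) auto
    also have "\<dots> \<le> fact ?n * exp \<bar>t\<bar>"
      using mult_mono[of 1 "fact ?n :: real" 1 "exp \<bar>t\<bar>"] by simp
    finally show ?thesis .
  next
    case False
    then have "\<bar>t\<bar> powr p \<le> \<bar>t\<bar> powr real ?n" by (intro powr_mono) linarith+
    also have "\<dots> = \<bar>t\<bar> ^ ?n" using False by (subst powr_realpow) auto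
    also have "\<bar>t\<bar> ^ ?n / fact ?n \<le> exp \<bar>t\<bar>"
    proof -
      have "(\<Sum>k\<in>{?n}. \<bar>t\<bar> ^ k /\<^sub>R fact k) \<le> (\<Sum>k. \<bar>t\<bar> ^ k /\<^sub>R fact k)"
        by (intro sum_le_suminf summable_exp_generic) auto
      then show ?thesis by (simp add: exp_def divide_inverse mult.commute)
    qed
    then have "\<bar>t\<bar> ^ ?n \<le> fact ?n * exp \<bar>t\<bar>" by (simp add: field_simps)
    finally show ?thesis .
  qed
  also have "exp \<bar>t\<bar> \<le> exp t + exp (- t)" by (cases "t \<ge> 0") auto
  finally show ?thesis by simp
qed

lemma sum_subsets_abs_powr_le:
  fixes f :: "'b \<Rightarrow> real"
  assumes V: "finite V" and f: "\<And>y. y \<in> V \<Longrightarrow> \<bar>f y\<bar> \<le> 1" and f0: "sum f V = 0"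
    and m: "m \<ge> 1" and p: "0 \<le> p"
  shows "(\<Sum>X | X \<subseteq> V \<and> card X = m. \<bar>sum f X\<bar> powr p) \<le>
         2 powr p * fact (nat \<lceil>p\<rceil>) * (2 * exp 1) * real (card V choose m) * real m powr (p / 2)"
proof -
  let ?A = "{X. X \<subseteq> V \<and> card X = m}"
  \<comment> \<open>This choice makes the variance term 4 l^2 m equal to 1, so both exponential
    moments are at most e times the number of samples. Undoing the scaling costs (1/l)^p = 2^p
    m^(p/2).\<close>
  define l where "l = 1 / (2 * sqrt m)"
  have sq: "sqrt m \<ge> 1" using m by simp
  have l: "\<bar>l\<bar> \<le> 1 / 2" "\<bar>- l\<bar> \<le> 1 / 2" "l > 0" using sq by (auto simp: l_def field_simps)
  have lm: "4 * l\<^sup>2 * real m = 1" using m by (simp add: l_def power_divide power_mult_distrib)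
  have e1: "(\<Sum>X\<in>?A. exp (l * sum f X)) \<le> real (card V choose m) * exp 1"
    using sum_subsets_exp_le[where f = f and m = m, OF V f l(1)] by (simp add: f0 lm)
  have e2: "(\<Sum>X\<in>?A. exp (- (l * sum f X))) \<le> real (card V choose m) * exp 1"
    using sum_subsets_exp_le[where f = f and m = m, OF V f l(2)] by (simp add: f0 lm)
  have inv: "(1 / l) powr p = 2 powr p * real m powr (p / 2)"
    using m by (simp add: l_def powr_mult powr_half_sqrt[symmetric] powr_powr)
  have "(\<Sum>X\<in>?A. \<bar>sum f X\<bar> powr p) = (\<Sum>X\<in>?A. (1 / l) powr p * \<bar>l * sum f X\<bar> powr p)"
    using l by (intro sum.cong refl) (simp add: abs_mult powr_mult[symmetric])
  also have "\<dots> \<le> (\<Sum>X\<in>?A. (1 / l) powr p *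
      (fact (nat \<lceil>p\<rceil>) * (exp (l * sum f X) + exp (- (l * sum f X)))))"
    by (intro sum_mono mult_left_mono abs_powr_le_exp p) auto
  also have "\<dots> = (1 / l) powr p * fact (nat \<lceil>p\<rceil>) *
      ((\<Sum>X\<in>?A. exp (l * sum f X)) + (\<Sum>X\<in>?A. exp (- (l * sum f X))))"
    by (simp add: sum.distrib mult.assoc flip: sum_distrib_left)
  also have "\<dots> \<le> (1 / l) powr p * fact (nat \<lceil>p\<rceil>) *
      (real (card V choose m) * exp 1 + real (card V choose m) * exp 1)"
    by (intro mult_left_mono add_mono e1 e2) auto
  finally show ?thesis by (simp add: inv algebra_simps)
qed

text \<open>The inner bracket is the constant for real summands. The factor 2 counts real and
  imaginary parts, and the outer \<open>2 powr p\<close> comes from |z| \<le> 2 max(|Re z|, |Im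
  z|).\<close>

definition moment_const :: "real \<Rightarrow> real" where
  "moment_const p = 2 powr p * (2 * (2 powr p * fact (nat \<lceil>p\<rceil>) * (2 * exp 1)))"

lemma moment_const_nonneg: "moment_const p \<ge> 0"
  by (simp add: moment_const_def)

text \<open>Real and imaginary parts of \<open>g\<close> are again bounded by 1 and sum to zero over
  \<open>V\<close>, so the real moment bound applies to each.\<close>

lemma sum_subsets_cmod_powr_le:
  fixes g :: "'b \<Rightarrow> complex"
  assumes V: "finite V" and g: "\<And>y. y \<in> V \<Longrightarrow> cmod (g y) \<le> 1" and g0: "sum g V = 0"
    and m: "m \<ge> 1" and p: "0 \<le> p"
  shows "(\<Sum>X | X \<subseteq> V \<and> card X = m. cmod (sum g X) powr p) \<le>
         moment_const p * real (card V choose m) * real m powr (p / 2)"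
proof -
  let ?A = "{X. X \<subseteq> V \<and> card X = m}"
  let ?B = "2 powr p * fact (nat \<lceil>p\<rceil>) * (2 * exp 1) * real (card V choose m) * real m powr (p / 2)"
  have split: "cmod z powr p \<le> 2 powr p * (\<bar>Re z\<bar> powr p + \<bar>Im z\<bar> powr p)" for z
  proof -
    let ?M = "max \<bar>Re z\<bar> \<bar>Im z\<bar>"
    have "cmod z \<le> 2 * ?M" using cmod_le[of z] by linarith
    then have "cmod z powr p \<le> (2 * ?M) powr p" using p by (intro powr_mono2) auto
    also have "\<dots> = 2 powr p * ?M powr p" by (simp add: powr_mult)
    also have "?M powr p \<le> \<bar>Re z\<bar> powr p + \<bar>Im z\<bar> powr p" by (simp add: max_def)
    finally show ?thesis by simp
  qed
  have re: "(\<Sum>X\<in>?A. \<bar>Re (sum g X)\<bar> powr p) \<le> ?B"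
    unfolding Re_sum
  proof (rule sum_subsets_abs_powr_le[OF V _ _ m p])
    show "\<bar>Re (g y)\<bar> \<le> 1" if "y \<in> V" for y
      using abs_Re_le_cmod[of "g y"] g[OF that] by linarith
    show "(\<Sum>y\<in>V. Re (g y)) = 0" using g0 by (simp flip: Re_sum)
  qed
  have im: "(\<Sum>X\<in>?A. \<bar>Im (sum g X)\<bar> powr p) \<le> ?B"
    unfolding Im_sum
  proof (rule sum_subsets_abs_powr_le[OF V _ _ m p])
    show "\<bar>Im (g y)\<bar> \<le> 1" if "y \<in> V" for y
      using abs_Im_le_cmod[of "g y"] g[OF that] by linarith
    show "(\<Sum>y\<in>V. Im (g y)) = 0" using g0 by (simp flip: Im_sum)
  qed
  have "(\<Sum>X\<in>?A. cmod (sum g X) powr p) \<le>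
      (\<Sum>X\<in>?A. 2 powr p * (\<bar>Re (sum g X)\<bar> powr p + \<bar>Im (sum g X)\<bar> powr p))"
    by (intro sum_mono split)
  also have "\<dots> = 2 powr p *
      ((\<Sum>X\<in>?A. \<bar>Re (sum g X)\<bar> powr p) + (\<Sum>X\<in>?A. \<bar>Im (sum g X)\<bar> powr p))"
    by (simp add: sum_distrib_left sum.distrib distrib_left)
  also have "\<dots> \<le> 2 powr p * (?B + ?B)"
    by (intro mult_left_mono add_mono re im) auto
  finally show ?thesis by (simp add: moment_const_def algebra_simps)
qed

section \<open>Character sums\<close>

lemma finite_vecs: "finite (carrier F) \<Longrightarrow> finite (vecs F d)"
  by (simp add: vecs_def finite_PiE)

lemma card_vecs: "card (vecs F d) = card (carrier F) ^ d"
  by (simp add: vecs_def card_PiE)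

lemma (in field) dot_closed:
  assumes "x \<in> vecs R d" "y \<in> vecs R d"
  shows "dot R d x y \<in> carrier R"
  using assms unfolding dot_def vecs_def by (intro finsum_closed) auto

text \<open>Only the summand with index \<open>i\<close> sees the update. This describes the effect
  of a translation along one coordinate, which is what makes the character sum vanish.\<close>

lemma (in field) dot_fun_upd_add:
  assumes x: "x \<in> vecs R d" and y: "y \<in> vecs R d" and i: "i < d" and b: "b \<in> carrier R"
  shows "dot R d x (y(i := y i \<oplus> b)) = dot R d x y \<oplus> x i \<otimes> b"
proof -
  let ?I = "{..<d} - {i}"
  have ins: "{..<d} = insert i ?I" using i by auto
  have xc: "x j \<in> carrier R" and yc: "y j \<in> carrier R" if "j < d" for j
    using x y that by (auto simp: vecs_def)
  have split: "dot R d x z = x i \<otimes> z i \<oplus> (\<Oplus>j\<in>?I. x j \<otimes> z j)"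
    if "\<And>j. j < d \<Longrightarrow> z j \<in> carrier R" for z
    unfolding dot_def using i xc that by (subst ins, subst finsum_insert) auto
  have "(\<Oplus>j\<in>?I. x j \<otimes> (y(i := y i \<oplus> b)) j) = (\<Oplus>j\<in>?I. x j \<otimes> y j)"
    using xc yc by (intro finsum_cong') auto
  moreover have "(\<Oplus>j\<in>?I. x j \<otimes> y j) \<in> carrier R"
    using xc yc by (intro finsum_closed) auto
  ultimately show ?thesis
    using i xc[OF i] yc[OF i] yc b by (subst (1 2) split) (auto simp: r_distr a_ac)
qed

text \<open>
  Translating \<open>y\<close> along a coordinate with \<open>x i \<noteq> 0\<close> multiplies the sum by \<open>\<psi> a \<noteq> 1\<close>.
\<close>

lemma (in field) character_sum_zero:
  assumes \<psi>: "nontrivial_additive_character R \<psi>"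
    and x: "x \<in> vecs R d" "x \<noteq> zero_vec R d"
  shows "(\<Sum>y\<in>vecs R d. \<psi> (\<ominus> dot R d x y)) = 0"
proof -
  have "\<exists>i<d. x i \<noteq> \<zero>"
  proof (rule ccontr)
    assume zero: "\<not> (\<exists>i<d. x i \<noteq> \<zero>)"
    have "x j = zero_vec R d j" for j
    proof (cases "j < d")
      case True
      then show ?thesis using zero by (simp add: zero_vec_def)
    next
      case False
      \<comment> \<open>Outside \<open>{..<d}\<close> both functions are \<open>undefined\<close> by
        extensionality.\<close>
      then show ?thesis
        using x(1) PiE_arb[of x "{..<d}" _ j] by (simp add: zero_vec_def vecs_def)
    qed
    then show False using x(2) by blast
  qed
  then obtain i where i: "i < d" "x i \<noteq> \<zero>" by blast
  have xi: "x i \<in> carrier R" "x i \<in> Units R"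
    using x(1) i by (auto simp: vecs_def field_Units)
  obtain a where a: "a \<in> carrier R" "\<psi> a \<noteq> 1"
    using \<psi> by (auto simp: nontrivial_additive_character_def)
  \<comment> \<open>Chosen so that the translation changes \<open>\<ominus> dot R d x y\<close> by
    exactly \<open>a\<close>.\<close>
  define b where "b = \<ominus> (inv (x i) \<otimes> a)"
  have b: "b \<in> carrier R" using a xi by (simp add: b_def)
  have "x i \<otimes> (inv (x i) \<otimes> a) = a"
    using xi a by (simp add: m_assoc[symmetric])
  then have xb: "\<ominus> (x i \<otimes> b) = a" using xi a by (simp add: b_def r_minus)
  let ?S = "\<Sum>y\<in>vecs R d. \<psi> (\<ominus> dot R d x y)"
  have yi: "y i \<in> carrier R" if "y \<in> vecs R d" for y
    using that i by (auto simp: vecs_def)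
  have upd: "y(i := c) \<in> vecs R d" if "y \<in> vecs R d" "c \<in> carrier R" for y c
    using that i by (auto simp: vecs_def PiE_def extensional_def)
  have "?S = (\<Sum>y\<in>vecs R d. \<psi> (\<ominus> dot R d x (y(i := y i \<oplus> b))))"
    by (rule sum.reindex_bij_witness
        [where i = "\<lambda>y. y(i := y i \<oplus> b)" and j = "\<lambda>y. y(i := y i \<oplus> \<ominus> b)"])
       (use b yi upd in \<open>auto simp: a_assoc l_neg r_neg\<close>)
  also have "\<dots> = (\<Sum>y\<in>vecs R d. \<psi> (\<ominus> dot R d x y) * \<psi> a)"
  proof (intro sum.cong refl)
    fix y assume y: "y \<in> vecs R d"
    have D: "dot R d x y \<in> carrier R" using x(1) y by (rule dot_closed)
    have "\<ominus> dot R d x (y(i := y i \<oplus> b)) = \<ominus> dot R d x y \<oplus> a"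
      using D xi b xb x(1) y i by (simp add: dot_fun_upd_add minus_add)
    then show "\<psi> (\<ominus> dot R d x (y(i := y i \<oplus> b))) = \<psi> (\<ominus> dot R d x y) * \<psi> a"
      using \<psi> D a by (simp add: nontrivial_additive_character_def additive_character_def)
  qed
  also have "\<dots> = ?S * \<psi> a" by (simp add: sum_distrib_right)
  finally show ?thesis using a by simp
qed

section \<open>Moments and tails of the Fourier transform of a random set\<close>

text \<open>For fixed nonzero \<open>x\<close>, the unnormalised coefficient is a sum over the
  sample of numbers of modulus 1 whose total over the whole space is zero, so the complex moment
  bound applies.\<close>

lemma (in field) sum_fourier_powr_le:
  assumes fin: "finite (carrier R)" and \<psi>: "nontrivial_additive_character R \<psi>"
    and x: "x \<in> vecs R d" "x \<noteq> zero_vec R d" and m: "m \<ge> 1" and p: "0 \<le> p"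
  defines "Q \<equiv> real (card (carrier R)) ^ d"
  shows "(\<Sum>X\<in>subsets_of_card R d m. cmod (fourier R d \<psi> X x) powr p) \<le>
         (1 / Q) powr p * (moment_const p * real (card (vecs R d) choose m) * real m powr (p / 2))"
proof -
  have "cmod (\<psi> (\<ominus> dot R d x y)) \<le> 1" if "y \<in> vecs R d" for y
    using \<psi> dot_closed[OF x(1) that]
    by (simp add: nontrivial_additive_character_def additive_character_def)
  then have "(\<Sum>X\<in>subsets_of_card R d m. cmod (\<Sum>y\<in>X. \<psi> (\<ominus> dot R d x y)) powr p) \<le>
      moment_const p * real (card (vecs R d) choose m) * real m powr (p / 2)"
    unfolding subsets_of_card_def
    by (intro sum_subsets_cmod_powr_le finite_vecs character_sum_zero fin \<psi> x m p)
  moreover have "cmod (fourier R d \<psi> X x) powr p =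
      (1 / Q) powr p * cmod (\<Sum>y\<in>X. \<psi> (\<ominus> dot R d x y)) powr p" for X
    by (simp add: fourier_def Q_def norm_mult norm_divide norm_power powr_mult[symmetric])
  ultimately show ?thesis
    by (simp add: sum_distrib_left[symmetric] mult_left_mono)
qed

text \<open>Markov's inequality for the \<open>p\<close>-th power of the norm, carried out by
  counting sets. Exchanging the sums over \<open>X\<close> and \<open>x\<close> reduces it to the
  moment bound for each single \<open>x\<close>.\<close>

lemma (in field) prob_fourier_norm_gt_le:
  assumes fin: "finite (carrier R)" and \<psi>: "nontrivial_additive_character R \<psi>"
    and m: "m \<ge> 1" "m \<le> card (vecs R d)" and p: "0 < p" and K: "K > 0"
  defines "Q \<equiv> real (card (carrier R)) ^ d"
  shows "measure_pmf.prob (pmf_of_set (subsets_of_card R d m))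
           {X. fourier_norm R d \<psi> p X > K * (1 / Q) * sqrt m} \<le> moment_const p / K powr p"
proof -
  let ?S = "subsets_of_card R d m"
  let ?W = "vecs R d - {zero_vec R d}"
  let ?B = "real (card (vecs R d) choose m)"
  define T where "T = K * (1 / Q) * sqrt m"
  let ?bad = "?S \<inter> {X. fourier_norm R d \<psi> p X > T}"
  have finV: "finite (vecs R d)" using fin by (rule finite_vecs)
  have cardV: "real (card (vecs R d)) = Q" by (simp add: card_vecs Q_def)
  have Q: "Q > 0" using m cardV by linarith
  have T: "T > 0" using K Q m by (simp add: T_def)
  have finS: "finite ?S" using finV by (simp add: subsets_of_card_def)
  have cardS: "real (card ?S) = ?B"
    using finV by (simp add: subsets_of_card_def n_subsets)
  have B: "?B > 0" using m by simp
  have ne: "?S \<noteq> {}" using B cardS by auto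
  have bad: "T powr p * Q \<le> (\<Sum>x\<in>?W. cmod (fourier R d \<psi> X x) powr p)" if "X \<in> ?bad" for X
  proof -
    let ?s = "\<Sum>x\<in>?W. cmod (fourier R d \<psi> X x) powr p"
    have s: "?s \<ge> 0" by (intro sum_nonneg) auto
    have "T \<le> ((1 / Q) * ?s) powr (1 / p)"
      using that by (simp add: fourier_norm_def Q_def)
    then have "T powr p \<le> (((1 / Q) * ?s) powr (1 / p)) powr p"
      using T p by (intro powr_mono2) auto
    also have "\<dots> = (1 / Q) * ?s" using p Q s by (simp add: powr_powr)
    finally show ?thesis using Q by (simp add: field_simps)
  qed
  have Tp: "T powr p = K powr p * ((1 / Q) powr p * real m powr (p / 2))"
    using K Q m by (simp add: T_def powr_mult powr_half_sqrt[symmetric] powr_powr powr_divide)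
  have "real (card ?bad) * (T powr p * Q) = (\<Sum>X\<in>?bad. T powr p * Q)" by simp
  also have "\<dots> \<le> (\<Sum>X\<in>?bad. \<Sum>x\<in>?W. cmod (fourier R d \<psi> X x) powr p)"
    by (intro sum_mono bad)
  also have "\<dots> \<le> (\<Sum>X\<in>?S. \<Sum>x\<in>?W. cmod (fourier R d \<psi> X x) powr p)"
    using finS by (intro sum_mono2 sum_nonneg) auto
  also have "\<dots> = (\<Sum>x\<in>?W. \<Sum>X\<in>?S. cmod (fourier R d \<psi> X x) powr p)"
    by (rule sum.swap)
  also have "\<dots> \<le> (\<Sum>x\<in>?W. (1 / Q) powr p * (moment_const p * ?B * real m powr (p / 2)))"
    unfolding Q_def using fin \<psi> m p by (intro sum_mono sum_fourier_powr_le) auto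
  also have "\<dots> = real (card ?W) * ((1 / Q) powr p * (moment_const p * ?B * real m powr (p / 2)))"
    by simp
  \<comment> \<open>There are at most \<open>Q\<close> frequencies \<open>x\<close>, which balances
    the factor 1/Q in the definition of the norm.\<close>
  also have "\<dots> \<le> Q * ((1 / Q) powr p * (moment_const p * ?B * real m powr (p / 2)))"
  proof (rule mult_right_mono)
    show "real (card ?W) \<le> Q"
      unfolding cardV[symmetric] using finV by (intro of_nat_mono card_mono) auto
  qed (simp add: moment_const_nonneg)
  finally have "(real (card ?bad) * K powr p) * (Q * ((1 / Q) powr p * real m powr (p / 2))) \<le>
      (moment_const p * ?B) * (Q * ((1 / Q) powr p * real m powr (p / 2)))"
    by (simp add: Tp mult_ac)
  \<comment> \<open>The threshold and the moment bound share the scale Q^(-p) m^(p/2), which cancels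
    and leaves only the power of \<open>K\<close>.\<close>
  then have "real (card ?bad) * K powr p \<le> moment_const p * ?B"
    by (rule mult_right_le_imp_le) (use Q m in simp)
  then have "real (card ?bad) / ?B \<le> moment_const p / K powr p"
    using B K by (simp add: field_simps)
  then show ?thesis
    using finS ne by (simp add: measure_pmf_of_set cardS T_def)
qed

section \<open>Asymptotics along prime powers\<close>

text \<open>The tail bound is applied with \<open>K = C q\<close>. Its constant
  \<open>moment_const p\<close> involves neither the field nor the character, so one implied
  constant serves the whole family.\<close>

theorem theorem5p1:
  fixes d :: nat and \<alpha> p :: real
    and F :: "nat \<Rightarrow> 'a ring" and \<psi> :: "nat \<Rightarrow> 'a \<Rightarrow> complex"
    and C :: "nat \<Rightarrow> real"
  assumes d: "d \<ge> 1"
    and \<alpha>: "0 < \<alpha>" "\<alpha> < real d"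
    and p: "2 \<le> p"
    and F: "\<And>q. primepow q \<Longrightarrow> field (F q) \<and> card (carrier (F q)) = q"
    and \<psi>: "\<And>q. primepow q \<Longrightarrow> nontrivial_additive_character (F q) (\<psi> q)"
    and C_pos: "\<And>n. n \<ge> 1 \<Longrightarrow> C n > 0"
    and C_mono: "mono_on {1..} C"
    and C_lim: "filterlim C at_top at_top"
  shows "let P = (\<lambda>q. measure_pmf.prob
             (pmf_of_set (subsets_of_card (F q) d (nat \<lfloor>real q powr \<alpha>\<rfloor>)))
             {X. fourier_norm (F q) d (\<psi> q) p X
                   > C q * real q powr (- real d) * real q powr (\<alpha> / 2)})
         in P \<in> O[primepow_at_top](\<lambda>q. 1 / C q) \<and> (P \<longlongrightarrow> 0) primepow_at_top"
proof -
  define P where "P = (\<lambda>q. measure_pmf.prob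
             (pmf_of_set (subsets_of_card (F q) d (nat \<lfloor>real q powr \<alpha>\<rfloor>)))
             {X. fourier_norm (F q) d (\<psi> q) p X
                   > C q * real q powr (- real d) * real q powr (\<alpha> / 2)})"
  have bound: "P q \<le> moment_const p * (1 / C q)" if q: "primepow q" and C: "C q \<ge> 1" for q
  proof -
    interpret field "F q" using F[OF q] by simp
    have card: "card (carrier (F q)) = q" using F[OF q] by simp
    have q2: "q > 1" using q primepow_gt_Suc_0 by auto
    \<comment> \<open>An infinite carrier would have \<open>card\<close> equal to 0.\<close>
    then have fin: "finite (carrier (F q))" using card card.infinite by fastforce
    define m where "m = nat \<lfloor>real q powr \<alpha>\<rfloor>"
    have q\<alpha>: "real q powr \<alpha> \<ge> 1" using q2 \<alpha> by (intro ge_one_powr_ge_zero) auto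
    have m1: "m \<ge> 1" using q\<alpha> by (simp add: m_def le_nat_iff)
    have mle: "real m \<le> real q powr \<alpha>" unfolding m_def using q\<alpha> by linarith
    also have "\<dots> \<le> real q powr real d" using q2 \<alpha> by (intro powr_mono) auto
    also have "\<dots> = real (card (vecs (F q) d))"
      using q2 by (simp add: card_vecs card powr_realpow)
    finally have m2: "m \<le> card (vecs (F q) d)" by simp
    have "sqrt m \<le> sqrt (real q powr \<alpha>)" using mle by simp
    also have "\<dots> = real q powr (\<alpha> / 2)" by (simp add: powr_half_sqrt[symmetric] powr_powr)
    finally have sqrt_m: "sqrt m \<le> real q powr (\<alpha> / 2)" .
    have Q: "1 / real q ^ d = real q powr (- real d)"
      using q2 by (simp add: powr_minus powr_realpow divide_inverse)
    have T: "C q * (1 / real q ^ d) * sqrt m \<le>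
        C q * real q powr (- real d) * real q powr (\<alpha> / 2)"
      unfolding Q using C sqrt_m by (intro mult_left_mono) auto
    \<comment> \<open>Rounding down gives sqrt m \<le> q^(\<alpha>/2), so replacing q^(\<alpha>/2)
      by sqrt m lowers the threshold and enlarges the event.\<close>
    have "P q \<le> measure_pmf.prob (pmf_of_set (subsets_of_card (F q) d m))
           {X. fourier_norm (F q) d (\<psi> q) p X > C q * (1 / real q ^ d) * sqrt m}"
      unfolding P_def m_def[symmetric]
      using T by (intro measure_pmf.finite_measure_mono) auto
    also have "\<dots> \<le> moment_const p / C q powr p"
      using prob_fourier_norm_gt_le[OF fin \<psi>[OF q] m1 m2, of p "C q"] p C by (simp add: card)
    \<comment> \<open>Here \<open>C q \<ge> 1\<close> enters: the decay C^(-p) is weakened to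
      C^(-1). Since \<open>C\<close> tends to infinity, this covers all large
      \<open>q\<close>.\<close>
    also have "\<dots> \<le> moment_const p / C q powr 1"
      using p C by (intro divide_left_mono powr_mono) (auto simp: moment_const_nonneg)
    finally show ?thesis using C by simp
  qed
  have le: "primepow_at_top \<le> at_top" by (simp add: primepow_at_top_def)
  have C_lim': "filterlim C at_top primepow_at_top"
    using C_lim le by (rule filterlim_mono[OF _ order_refl])
  have "eventually primepow primepow_at_top"
    by (simp add: primepow_at_top_def eventually_inf_principal)
  moreover have "eventually (\<lambda>q. C q \<ge> 1) primepow_at_top"
    using C_lim' by (simp add: filterlim_at_top)
  ultimately have ev: "eventually (\<lambda>q. norm (P q) \<le> moment_const p * norm (1 / C q)) primepow_at_top"
  proof eventually_elim
    case (elim q)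
    have "P q \<ge> 0" by (simp add: P_def)
    then show ?case using bound[OF elim] elim by simp
  qed
  then have big: "P \<in> O[primepow_at_top](\<lambda>q. 1 / C q)"
    by (rule landau_o.bigI[rotated]) (simp add: moment_const_def)
  have "((\<lambda>q. 1 / C q) \<longlongrightarrow> 0) primepow_at_top"
    using C_lim' by (intro tendsto_divide_0[OF tendsto_const] filterlim_at_top_imp_at_infinity)
  then have "((\<lambda>q. moment_const p * norm (1 / C q)) \<longlongrightarrow> 0) primepow_at_top"
    by (intro tendsto_mult_right_zero tendsto_norm_zero)
  with ev have "(P \<longlongrightarrow> 0) primepow_at_top"
    by (rule Lim_null_comparison)
  with big show ?thesis
    by (simp add: Let_def P_def)
qed

end
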